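(* Let $X$ be a compact metrizable space of finite (Lebesgue covering) dimension, and let $\Phi$ be a topological flow on $X$ without fixed points and having a countable number of periodic orbits. Then $(X,\Phi)$ has the small flow boundary property.
   Context: A topological flow $(X,\Phi)$ is a compact metrizable space $X$ with a continuous map $\Phi:X\times\mathbb{R}\to X$, $\Phi_t(x)=\Phi(x,t)$, such that $\Phi_0=\mathrm{Id}$ and $\Phi_s\circ\Phi_t=\Phi_{s+t}$. For $L\subset\mathbb{R}$, $S\subset X$ put $\Phi_L(S)=\{\Phi_t(x): t\in L, x\in S\}$. A point $x$ is fixed if $\Phi_t(x)=x$ for all $t$; it is periodic with period $\tau>0$ if $\Phi_\tau(x)=x$ and $\Phi_t(x)\neq x$ for $0<t<\tau$, and then $\{\Phi_t(x):0\le t\le\tau\}$ is its periodic orbit. A cross-section of injectivity time $\eta>0$ is a subset $S\subset X$ such that $\Phi$ restricted to $S\times[-\eta,\eta]$ is one-to-one. For a set $U$ contained in a closed cross-section of injectivity time $\eta$, the flow interior is $\mathrm{Int}^{\Phi}(U)=\mathrm{Int}(\Phi_{[-\gamma,\gamma]}(U))\cap U$ (for any $0<\gamma<\eta$; the set does not depend on $\gamma$) and the flow boundary is $\partial^{\Phi}U=\overline{U}\setminus \mathrm{Int}^{\Phi}(U)$, interior and closure being taken in $X$. A Borel set is a null set if it has measure zero for every $\Phi$-invariant Borel probability measure. A closed cross-section $S$ of injectivity time $\eta$ has a small flow boundary if $\Phi_{[-\eta,\eta]}(\partial^{\Phi}S)$ is a null set. The flow $(X,\Phi)$ has the small flow boundary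 property if for every $x\in X$ and every closed cross-section $S'$ with $x\in\mathrm{Int}^{\Phi}(S')$ there is a closed subset $S\subset S'$ such that $x\in \mathrm{Int}^{\Phi}(S)$ and $S$ has a small flow boundary. *)

theory Defs
  imports "HOL-Probability.Probability"
begin

text \<open>
  A flow is a map \<open>\<Phi> :: 'a \<times> real \<Rightarrow> 'a\<close> on the whole type, so \<open>\<Phi>\<^sub>t(x)\<close> is written \<open>\<Phi> (x, t)\<close> and
  \<open>\<Phi>\<^sub>L(S)\<close> is the image \<open>\<Phi> ` (S \<times> L)\<close>.  Compactness of the space is assumed separately where needed.
\<close>

definition topological_flow :: "('a::topological_space \<times> real \<Rightarrow> 'a) \<Rightarrow> bool" where
  "topological_flow \<Phi> \<longleftrightarrow>
     continuous_on UNIV \<Phi> \<and>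
     (\<forall>x. \<Phi> (x, 0) = x) \<and>
     (\<forall>s t x. \<Phi> (\<Phi> (x, t), s) = \<Phi> (x, s + t))"

definition fixed_point :: "('a \<times> real \<Rightarrow> 'a) \<Rightarrow> 'a \<Rightarrow> bool" where
  "fixed_point \<Phi> x \<longleftrightarrow> (\<forall>t. \<Phi> (x, t) = x)"

definition periodic_with_period :: "('a \<times> real \<Rightarrow> 'a) \<Rightarrow> 'a \<Rightarrow> real \<Rightarrow> bool" where
  "periodic_with_period \<Phi> x \<tau> \<longleftrightarrow>
     \<tau> > 0 \<and> \<Phi> (x, \<tau>) = x \<and> (\<forall>t. 0 < t \<and> t < \<tau> \<longrightarrow> \<Phi> (x, t) \<noteq> x)"

definition periodic_orbits :: "('a \<times> real \<Rightarrow> 'a) \<Rightarrow> 'a set set" where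
  "periodic_orbits \<Phi> = {\<Phi> ` ({x} \<times> {0..\<tau>}) | x \<tau>. periodic_with_period \<Phi> x \<tau>}"

definition cross_section :: "('a \<times> real \<Rightarrow> 'a) \<Rightarrow> real \<Rightarrow> 'a set \<Rightarrow> bool" where
  "cross_section \<Phi> \<eta> S \<longleftrightarrow> \<eta> > 0 \<and> inj_on \<Phi> (S \<times> {-\<eta>..\<eta>})"

text \<open>
  The flow interior of a set \<open>U\<close> contained in a closed cross-section of injectivity time \<open>\<eta>\<close>.
  It is formed with \<open>\<gamma> = \<eta>/2\<close>; by \<open>flow_interior_eq\<close> below any \<open>0 < \<gamma> < \<eta>\<close> gives the same set.
\<close>

definition flow_interior :: "('a::topological_space \<times> real \<Rightarrow> 'a) \<Rightarrow> real \<Rightarrow> 'a set \<Rightarrow> 'a set" where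
  "flow_interior \<Phi> \<eta> U = interior (\<Phi> ` (U \<times> {-(\<eta>/2)..\<eta>/2})) \<inter> U"

definition flow_boundary :: "('a::topological_space \<times> real \<Rightarrow> 'a) \<Rightarrow> real \<Rightarrow> 'a set \<Rightarrow> 'a set" where
  "flow_boundary \<Phi> \<eta> U = closure U - flow_interior \<Phi> \<eta> U"

definition invariant_prob :: "('a::topological_space \<times> real \<Rightarrow> 'a) \<Rightarrow> 'a measure \<Rightarrow> bool" where
  "invariant_prob \<Phi> M \<longleftrightarrow>
     prob_space M \<and> sets M = sets borel \<and> (\<forall>t. distr M M (\<lambda>x. \<Phi> (x, t)) = M)"

definition flow_null :: "('a::topological_space \<times> real \<Rightarrow> 'a) \<Rightarrow> 'a set \<Rightarrow> bool" where
  "flow_null \<Phi> A \<longleftrightarrow> A \<in> sets borel \<and> (\<forall>M. invariant_prob \<Phi> M \<longrightarrow> emeasure M A = 0)"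

definition small_flow_boundary :: "('a::topological_space \<times> real \<Rightarrow> 'a) \<Rightarrow> real \<Rightarrow> 'a set \<Rightarrow> bool" where
  "small_flow_boundary \<Phi> \<eta> S \<longleftrightarrow>
     closed S \<and> cross_section \<Phi> \<eta> S \<and> flow_null \<Phi> (\<Phi> ` (flow_boundary \<Phi> \<eta> S \<times> {-\<eta>..\<eta>}))"

text \<open>A subset \<open>S\<close> of \<open>S'\<close> is again a cross-section of injectivity time \<open>\<eta>\<close>, so one \<open>\<eta>\<close> serves for both.\<close>

definition small_flow_boundary_property :: "('a::topological_space \<times> real \<Rightarrow> 'a) \<Rightarrow> bool" where
  "small_flow_boundary_property \<Phi> \<longleftrightarrow>
     (\<forall>x \<eta> S'. closed S' \<and> cross_section \<Phi> \<eta> S' \<and> x \<in> flow_interior \<Phi> \<eta> S' \<longrightarrow>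
        (\<exists>S. closed S \<and> S \<subseteq> S' \<and> x \<in> flow_interior \<Phi> \<eta> S \<and> small_flow_boundary \<Phi> \<eta> S))"

definition covering_dim_le :: "'a topology \<Rightarrow> nat \<Rightarrow> bool" where
  "covering_dim_le T n \<longleftrightarrow>
     (\<forall>\<U>. finite \<U> \<and> (\<forall>U\<in>\<U>. openin T U) \<and> \<Union>\<U> = topspace T \<longrightarrow>
        (\<exists>\<V>. finite \<V> \<and> (\<forall>V\<in>\<V>. openin T V) \<and> \<Union>\<V> = topspace T \<and>
             (\<forall>V\<in>\<V>. \<exists>U\<in>\<U>. V \<subseteq> U) \<and>
             (\<forall>x\<in>topspace T. card {V\<in>\<V>. x \<in> V} \<le> n + 1)))"

definition finite_covering_dim :: "'a topology \<Rightarrow> bool" where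
  "finite_covering_dim T \<longleftrightarrow> (\<exists>n. covering_dim_le T n)"

lemma interior_flow_box_mono:
  fixes \<Phi> :: "'a::t2_space \<times> real \<Rightarrow> 'a"
  assumes "compact (UNIV :: 'a set)" and flow: "topological_flow \<Phi>"
    and S: "closed S" "cross_section \<Phi> \<eta> S" "U \<subseteq> S"
    and \<gamma>: "0 < \<gamma>" "\<gamma> < \<eta>" and \<delta>: "0 < \<delta>" "\<delta> < \<eta>"
  shows "interior (\<Phi> ` (U \<times> {-\<gamma>..\<gamma>})) \<inter> U \<subseteq> interior (\<Phi> ` (U \<times> {-\<delta>..\<delta>}))"
proof
  fix x assume x: "x \<in> interior (\<Phi> ` (U \<times> {-\<gamma>..\<gamma>})) \<inter> U"
  define K where "K = \<Phi> ` (S \<times> ({-\<gamma>..\<gamma>} - {-\<delta><..<\<delta>}))"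
  have "compact S"
    using compact_Int_closed[OF assms(1) S(1)] by simp
  then have "compact K"
    unfolding K_def using flow
    by (intro compact_continuous_image compact_Times compact_diff)
      (auto simp: topological_flow_def intro: continuous_on_subset)
  then have "closed K" by (rule compact_imp_closed)
  have "x \<notin> K"
  proof
    assume "x \<in> K"
    then obtain s t where st: "s \<in> S" "t \<in> {-\<gamma>..\<gamma>} - {-\<delta><..<\<delta>}" "\<Phi> (s, t) = x"
      unfolding K_def by (elim imageE SigmaE) simp
    have "\<Phi> (x, 0) = x" using flow by (simp add: topological_flow_def)
    then have "(s, t) = (x, 0)"
      using S x st \<gamma> by (intro inj_onD[of \<Phi> "S \<times> {-\<eta>..\<eta>}"]) (auto simp: cross_section_def)
    then show False using st \<delta> by auto
  qed
  have "interior (\<Phi> ` (U \<times> {-\<gamma>..\<gamma>})) \<inter> - K \<subseteq> \<Phi> ` (U \<times> {-\<delta>..\<delta>})"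
  proof
    fix y assume y: "y \<in> interior (\<Phi> ` (U \<times> {-\<gamma>..\<gamma>})) \<inter> - K"
    then obtain u t where ut: "u \<in> U" "t \<in> {-\<gamma>..\<gamma>}" "y = \<Phi> (u, t)"
      using interior_subset by fastforce
    have "t \<in> {-\<delta><..<\<delta>}"
      using y ut S(3) unfolding K_def by blast
    then show "y \<in> \<Phi> ` (U \<times> {-\<delta>..\<delta>})" using ut by auto
  qed
  then show "x \<in> interior (\<Phi> ` (U \<times> {-\<delta>..\<delta>}))"
    using x \<open>x \<notin> K\<close> \<open>closed K\<close> by (intro interiorI[of "interior (\<Phi> ` (U \<times> {-\<gamma>..\<gamma>})) \<inter> - K"]) auto
qed

lemma flow_interior_eq:
  fixes \<Phi> :: "'a::t2_space \<times> real \<Rightarrow> 'a"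
  assumes "compact (UNIV :: 'a set)" "topological_flow \<Phi>"
    and "closed S" "cross_section \<Phi> \<eta> S" "U \<subseteq> S" "0 < \<gamma>" "\<gamma> < \<eta>"
  shows "flow_interior \<Phi> \<eta> U = interior (\<Phi> ` (U \<times> {-\<gamma>..\<gamma>})) \<inter> U"
  unfolding flow_interior_def
  using interior_flow_box_mono[OF assms(1-5), of \<gamma> "\<eta>/2"]
    interior_flow_box_mono[OF assms(1-5), of "\<eta>/2" \<gamma>] assms(6,7)
  by fastforce

end

theory Submission imports Defs begin

text \<open>
  A closed neighbourhood of \<open>x\<close> in the cross-section \<open>S'\<close> is cut out as \<open>S = {y \<in> S'. f y \<le> 0}\<close>, where
  \<open>f\<close> is a small generic perturbation of the function \<open>y \<mapsto> dist x y - r\<close>. The flow boundary of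
  \<open>S\<close> then lies in the zero set of \<open>f\<close> (\<open>sublevel_flow_interior\<close>), so this zero set has to be thin
  along every orbit.

  The thinness comes from counting dimensions. Suppose that the space has dimension at most \<open>n\<close>. The
  condition that \<open>f\<close> vanishes at \<open>n + 1\<close> distinct points of one orbit consists of \<open>n + 1\<close> equations
  on a base point that ranges over a space of dimension \<open>n\<close>, because the return times to a cross-section
  are locally functions of the base point (\<open>return_map\<close>). As the points are distinct, the values of
  \<open>f\<close> at them can be changed independently, and a map from an \<open>n\<close>-dimensional compact space to
  \<open>\<real>\<^bsup>n+1\<^esup>\<close> can be made to miss the origin (\<open>perturb_to_avoid_common_zero\<close>). Countably many such
  conditions suffice, so by Baire's theorem a generic \<open>f\<close> has at most \<open>n\<close> zeros in \<open>S'\<close> on each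
  orbit, and none at the countably many periodic points of \<open>S'\<close>
  (\<open>generic_function_avoids_visits\<close>).

  An orbit is then rarely near the flow boundary \<open>B\<close>: it is in \<open>\<Phi>\<^bsub>[-\<eta>,\<eta>]\<^esub>(B)\<close> at no more than \<open>n\<close>
  of the times \<open>0, 3\<eta>, 6\<eta>, \<dots>\<close> (\<open>finite_visits_imp_flow_null\<close>). A set visited so rarely has measure zero for every invariant probability measure, since integrating the number of
  visits up to the \<open>N\<close>-th time gives \<open>N\<close> times the measure, but at most \<open>n\<close>
  (\<open>bounded_visits_imp_null\<close>).
\<close>

section \<open>General position of finitely many vectors\<close>

text \<open>
  Each \<open>c \<in> \<C>\<close> defines a proper hyperplane of \<open>\<real>\<^sup>V\<close>. The hyperplanes are escaped one at a
  time: moving along a coordinate axis transversal to the new hyperplane leaves it at once, and a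
  short move does not reach the finitely many hyperplanes already avoided.
\<close>
lemma avoid_finitely_many_hyperplanes:
  fixes b :: "'v \<Rightarrow> real"
  assumes "finite V" "finite \<C>" "\<And>c. c \<in> \<C> \<Longrightarrow> \<exists>v\<in>V. c v \<noteq> 0" "\<epsilon> > 0"
  shows "\<exists>a. (\<forall>v\<in>V. \<bar>a v - b v\<bar> < \<epsilon>) \<and> (\<forall>c\<in>\<C>. (\<Sum>v\<in>V. c v * a v) \<noteq> 0)"
  using assms(2,3)
proof (induction \<C> rule: finite_induct)
  case empty
  then show ?case using \<open>\<epsilon> > 0\<close> by (intro exI[of _ b]) auto
next
  case (insert c \<C>)
  then obtain a where a: "\<forall>v\<in>V. \<bar>a v - b v\<bar> < \<epsilon>" "\<forall>c\<in>\<C>. (\<Sum>v\<in>V. c v * a v) \<noteq> 0"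
    by auto
  obtain w where w: "w \<in> V" "c w \<noteq> 0" using insert.prems by auto
  have sum_upd: "(\<Sum>v\<in>V. k v * (a(w := a w + s)) v) = (\<Sum>v\<in>V. k v * a v) + k w * s" for k s
  proof -
    have "(\<Sum>v\<in>V. k v * (a(w := a w + s)) v) = (\<Sum>v\<in>V. k v * a v + (if v = w then k w * s else 0))"
      by (intro sum.cong) (auto simp: algebra_simps)
    then show ?thesis using \<open>finite V\<close> w(1) by (simp add: sum.distrib)
  qed
  have "\<forall>\<^sub>F s in at_right 0. \<bar>a w + s - b w\<bar> < \<epsilon>"
  proof (rule order_tendstoD(2))
    show "((\<lambda>s. \<bar>a w + s - b w\<bar>) \<longlongrightarrow> \<bar>a w + 0 - b w\<bar>) (at_right 0)"
      by (intro tendsto_intros)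
  qed (use a(1) w(1) in auto)
  moreover have "\<forall>\<^sub>F s in at_right 0. \<forall>k\<in>\<C>. (\<Sum>v\<in>V. k v * a v) + k w * s \<noteq> 0"
  proof (intro eventually_ball_finite ballI \<open>finite \<C>\<close>)
    fix k assume "k \<in> \<C>"
    moreover have "((\<lambda>s. (\<Sum>v\<in>V. k v * a v) + k w * s) \<longlongrightarrow> (\<Sum>v\<in>V. k v * a v) + k w * 0) (at_right 0)"
      by (intro tendsto_intros)
    ultimately show "\<forall>\<^sub>F s in at_right 0. (\<Sum>v\<in>V. k v * a v) + k w * s \<noteq> 0"
      using a(2) by (intro tendsto_imp_eventually_ne) auto
  qed
  moreover have "\<forall>\<^sub>F s in at_right 0. s \<noteq> - (\<Sum>v\<in>V. c v * a v) / c w"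
  proof (cases "(\<Sum>v\<in>V. c v * a v) = 0")
    case True
    then show ?thesis using eventually_at_right_less[of "0::real"] by (auto elim: eventually_mono)
  next
    case False
    then show ?thesis using w(2)
      by (intro tendsto_imp_eventually_ne[of _ 0]) auto
  qed
  ultimately have "\<forall>\<^sub>F s in at_right 0. \<bar>a w + s - b w\<bar> < \<epsilon> \<and>
      (\<forall>k\<in>insert c \<C>. (\<Sum>v\<in>V. k v * a v) + k w * s \<noteq> 0)"
  proof eventually_elim
    case (elim s)
    have "(\<Sum>v\<in>V. c v * a v) + c w * s \<noteq> 0"
    proof
      assume "(\<Sum>v\<in>V. c v * a v) + c w * s = 0"
      then have "s = - (\<Sum>v\<in>V. c v * a v) / c w" using w(2) by (simp add: field_simps add_eq_0_iff)
      then show False using elim by simp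
    qed
    then show ?case using elim by auto
  qed
  then obtain s where "\<bar>a w + s - b w\<bar> < \<epsilon>" "\<forall>k\<in>insert c \<C>. (\<Sum>v\<in>V. k v * a v) + k w * s \<noteq> 0"
    using eventually_happens'[OF trivial_limit_at_right_real] by blast
  then show ?case
    using a(1) sum_upd by (intro exI[of _ "a(w := a w + s)"]) (simp del: fun_upd_apply, simp)
qed

text \<open>
  A finite family of vectors of \<open>\<real>\<^sup>m\<close> can be moved slightly so that any \<open>m\<close> of them are linearly
  independent. The induction adds one row at a time. If any \<open>m\<close> vectors are independent after
  \<open>m\<close> rows, then \<open>m + 1\<close> of them satisfy at most one linear relation up to scaling; the next row
  only has to violate each of these finitely many relations, that is, to avoid hyperplanes.
\<close>
lemma general_position:
  fixes b :: "'v \<Rightarrow> nat \<Rightarrow> real"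
  assumes "finite V" "\<epsilon> > 0"
  shows "\<exists>a. (\<forall>v\<in>V. \<forall>i<m. \<bar>a v i - b v i\<bar> < \<epsilon>) \<and>
    (\<forall>J c. J \<subseteq> V \<longrightarrow> card J \<le> m \<longrightarrow> (\<forall>i<m. (\<Sum>v\<in>J. c v * a v i) = 0) \<longrightarrow> (\<forall>v\<in>J. c v = 0))"
proof (induction m)
  case 0
  then show ?case using finite_subset[OF _ \<open>finite V\<close>] by auto
next
  case (Suc m)
  then obtain a where near: "\<forall>v\<in>V. \<forall>i<m. \<bar>a v i - b v i\<bar> < \<epsilon>"
    and indep_all: "\<forall>J c. J \<subseteq> V \<longrightarrow> card J \<le> m \<longrightarrow> (\<forall>i<m. (\<Sum>v\<in>J. c v * a v i) = 0) \<longrightarrow> (\<forall>v\<in>J. c v = 0)"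
    by (elim exE conjE)
  have indep: "c v = 0"
    if "J \<subseteq> V" "card J \<le> m" "\<forall>i<m. (\<Sum>v\<in>J. c v * a v i) = 0" "v \<in> J" for J c v
    using indep_all[THEN spec, THEN spec, THEN mp, OF that(1), of c] that(2-4) by simp
  \<comment> \<open>A nontrivial relation is extended by \<open>0\<close> outside \<open>J\<close>, so that it is a linear form on \<open>\<real>\<^sup>V\<close>.\<close>
  define rel where "rel J c \<longleftrightarrow> (\<forall>i<m. (\<Sum>v\<in>J. c v * a v i) = 0) \<and> (\<forall>v. v \<notin> J \<longrightarrow> c v = 0)
      \<and> (\<exists>v\<in>J. c v \<noteq> 0)" for J and c :: "'v \<Rightarrow> real"
  define \<J> where "\<J> = {J. J \<subseteq> V \<and> card J \<le> Suc m \<and> (\<exists>c. rel J c)}"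
  define k where "k J = (SOME c. rel J c)" for J
  have rel_k: "rel J (k J)" if "J \<in> \<J>" for J
    using that someI_ex[of "rel J"] by (auto simp: k_def \<J>_def)
  have "finite (k ` \<J>)" using \<open>finite V\<close> by (auto simp: \<J>_def)
  moreover have "\<exists>v\<in>V. c v \<noteq> 0" if "c \<in> k ` \<J>" for c
  proof -
    from that obtain J where J: "J \<in> \<J>" "c = k J" by auto
    then show ?thesis using rel_k[OF J(1)] unfolding rel_def \<J>_def by blast
  qed
  ultimately obtain \<alpha> where \<alpha>: "\<forall>v\<in>V. \<bar>\<alpha> v - b v m\<bar> < \<epsilon>" "\<forall>c\<in>k ` \<J>. (\<Sum>v\<in>V. c v * \<alpha> v) \<noteq> 0"
    using avoid_finitely_many_hyperplanes[of V "k ` \<J>" \<epsilon> "\<lambda>v. b v m"] assms by metis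
  have \<alpha>_J: "(\<Sum>v\<in>J. k J v * \<alpha> v) \<noteq> 0" if "J \<in> \<J>" for J
  proof -
    have "(\<Sum>v\<in>J. k J v * \<alpha> v) = (\<Sum>v\<in>V. k J v * \<alpha> v)"
      using that rel_k[OF that] \<open>finite V\<close> by (intro sum.mono_neutral_left) (auto simp: \<J>_def rel_def)
    then show ?thesis using \<alpha>(2) that by auto
  qed
  have zero: "c v = 0"
    if J: "J \<subseteq> V" "card J \<le> Suc m" and c: "\<And>i. i < m \<Longrightarrow> (\<Sum>v\<in>J. c v * a v i) = 0"
      and c': "(\<Sum>v\<in>J. c v * \<alpha> v) = 0" and "v \<in> J" for J c v
  proof (rule ccontr)
    assume "c v \<noteq> 0"
    have "finite J" using J finite_subset \<open>finite V\<close> by auto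
    have "rel J (\<lambda>v. if v \<in> J then c v else 0)"
      using c \<open>c v \<noteq> 0\<close> \<open>v \<in> J\<close> by (auto simp: rel_def)
    then have "J \<in> \<J>" using J by (auto simp: \<J>_def)
    define l where "l = k J v / c v"
    \<comment> \<open>The combination \<open>k J - l c\<close> is a relation that no longer involves \<open>v\<close>, so it is trivial.\<close>
    have "k J u - l * c u = 0" if "u \<in> J" for u
    proof (cases "u = v")
      case True
      then show ?thesis using \<open>c v \<noteq> 0\<close> by (simp add: l_def)
    next
      case False
      have "(\<Sum>u\<in>J - {v}. (k J u - l * c u) * a u i) = 0" if "i < m" for i
      proof -
        have "(\<Sum>u\<in>J - {v}. (k J u - l * c u) * a u i) = (\<Sum>u\<in>J. (k J u - l * c u) * a u i)"
          using \<open>finite J\<close> \<open>v \<in> J\<close> \<open>c v \<noteq> 0\<close> by (simp add: sum.remove[of J v] l_def)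
        also have "\<dots> = (\<Sum>u\<in>J. k J u * a u i) - l * (\<Sum>u\<in>J. c u * a u i)"
          by (simp add: algebra_simps sum_subtractf sum_distrib_left)
        finally show ?thesis using rel_k[OF \<open>J \<in> \<J>\<close>] c that by (simp add: rel_def)
      qed
      moreover have "J - {v} \<subseteq> V" "card (J - {v}) \<le> m"
        using J \<open>finite J\<close> \<open>v \<in> J\<close> by auto
      ultimately show ?thesis
        using indep[of "J - {v}" "\<lambda>u. k J u - l * c u" u] that False by blast
    qed
    then have "(\<Sum>u\<in>J. k J u * \<alpha> u) = (\<Sum>u\<in>J. l * (c u * \<alpha> u))"
      by (intro sum.cong) auto
    also have "\<dots> = 0" using c' by (simp flip: sum_distrib_left)
    finally show False using \<alpha>_J[OF \<open>J \<in> \<J>\<close>] by simp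
  qed
  show ?case
  proof (intro exI[of _ "\<lambda>v i. if i = m then \<alpha> v else a v i"] conjI allI ballI impI)
    fix J c v
    assume J: "J \<subseteq> V" "card J \<le> Suc m" "v \<in> J"
      and c: "\<forall>i<Suc m. (\<Sum>v\<in>J. c v * (if i = m then \<alpha> v else a v i)) = 0"
    have "(\<Sum>v\<in>J. c v * a v i) = 0" if "i < m" for i
      using c[rule_format, of i] that by simp
    then show "c v = 0" using zero[OF J(1,2) _ _ J(3)] c[rule_format, of m] by simp
  qed (use near \<alpha> in \<open>auto simp: less_Suc_eq\<close>)
qed

section \<open>Generic functions on spaces of finite covering dimension\<close>

text \<open>
  A map from a space of dimension \<open>n\<close> to \<open>\<real>\<^bsup>n+1\<^esup>\<close> can be pushed off the origin. Attach to each member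
  of a fine cover of order \<open>n + 1\<close> a vector close to the values of \<open>h\<close> there, the vectors being in
  general position, and average them with a partition of unity subordinate to the cover. At every point
  at most \<open>n + 1\<close> vectors enter, so the average is a nontrivial combination of independent vectors
  and cannot vanish.
\<close>
lemma perturb_to_avoid_common_zero:
  fixes h :: "nat \<Rightarrow> 'a::metric_space \<Rightarrow> real"
  assumes X: "compact (UNIV::'a set)" and dim: "covering_dim_le (euclidean::'a topology) n"
    and Q: "compact Q" and h: "\<And>i. i < Suc n \<Longrightarrow> continuous_on Q (h i)" and "\<epsilon> > 0"
  shows "\<exists>h'. (\<forall>i<Suc n. continuous_on Q (h' i)) \<and> (\<forall>i<Suc n. \<forall>y\<in>Q. \<bar>h' i y - h i y\<bar> \<le> \<epsilon>) \<and>
    (\<forall>y\<in>Q. \<exists>i<Suc n. h' i y \<noteq> 0)"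
proof -
  have "\<exists>\<delta>>0. \<forall>y\<in>Q. \<forall>z\<in>Q. dist y z < \<delta> \<longrightarrow> \<bar>h i y - h i z\<bar> < \<epsilon>/2" if "i < Suc n" for i
  proof -
    have "uniformly_continuous_on Q (h i)" using compact_uniformly_continuous[OF h[OF that] Q] .
    then obtain d where "d > 0" "\<forall>x\<in>Q. \<forall>x'\<in>Q. dist x' x < d \<longrightarrow> dist (h i x') (h i x) < \<epsilon>/2"
      using \<open>\<epsilon> > 0\<close> unfolding uniformly_continuous_on_def by (metis half_gt_zero)
    then show ?thesis by (auto simp: dist_real_def)
  qed
  then obtain d where d: "\<And>i. i < Suc n \<Longrightarrow> d i > 0"
    "\<And>i y z. i < Suc n \<Longrightarrow> y \<in> Q \<Longrightarrow> z \<in> Q \<Longrightarrow> dist y z < d i \<Longrightarrow> \<bar>h i y - h i z\<bar> < \<epsilon>/2"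
    by metis
  define \<delta> where "\<delta> = Min (d ` {..<Suc n})"
  have "\<delta> > 0" unfolding \<delta>_def by (subst Min_gr_iff) (use d(1) in auto)
  have \<delta>: "\<bar>h i y - h i z\<bar> < \<epsilon>/2" if "i < Suc n" "y \<in> Q" "z \<in> Q" "dist y z < \<delta>" for i y z
  proof -
    have "\<delta> \<le> d i" unfolding \<delta>_def using that by (intro Min_le) auto
    then show ?thesis using d(2) that by force
  qed
  obtain T where T: "finite T" "(UNIV::'a set) \<subseteq> (\<Union>x\<in>T. ball x (\<delta>/2))"
    using X \<open>\<delta> > 0\<close> compact_eq_totally_bounded[of "UNIV::'a set"] by (metis half_gt_zero)
  have "\<exists>\<V>. finite \<V> \<and> (\<forall>V\<in>\<V>. open V) \<and> \<Union>\<V> = (UNIV::'a set) \<and>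
      (\<forall>V\<in>\<V>. \<exists>U\<in>(\<lambda>x. ball x (\<delta>/2)) ` T. V \<subseteq> U) \<and> (\<forall>x. card {V\<in>\<V>. x \<in> V} \<le> n + 1)"
    (is "\<exists>\<V>. ?refines \<V>")
    using dim[unfolded covering_dim_le_def, rule_format, of "(\<lambda>x. ball x (\<delta>/2)) ` T"] T by auto
  then obtain \<V> where "?refines \<V>" by (rule exE)
  then have \<V>: "finite \<V>" "\<And>V. V \<in> \<V> \<Longrightarrow> open V" "\<Union>\<V> = (UNIV::'a set)"
    "\<And>V. V \<in> \<V> \<Longrightarrow> \<exists>U\<in>(\<lambda>x. ball x (\<delta>/2)) ` T. V \<subseteq> U" "\<And>x. card {V\<in>\<V>. x \<in> V} \<le> n + 1"
    by simp_all
  \<comment> \<open>Only the members that meet \<open>Q\<close> have sample values of \<open>h\<close>.\<close>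
  define \<W> where "\<W> = {V\<in>\<V>. V \<inter> Q \<noteq> {}}"
  have "finite \<W>" using \<V>(1) by (simp add: \<W>_def)
  have "\<forall>V\<in>\<W>. \<exists>y. y \<in> V \<inter> Q" by (auto simp: \<W>_def)
  then obtain p where "\<forall>V\<in>\<W>. p V \<in> V \<inter> Q" by (rule bchoice[THEN exE])
  then have p: "p V \<in> V \<inter> Q" if "V \<in> \<W>" for V using that by (rule bspec)
  obtain a where a_all: "\<forall>V\<in>\<W>. \<forall>i<Suc n. \<bar>a V i - h i (p V)\<bar> < \<epsilon>/2"
    and indep_all: "\<forall>J c. J \<subseteq> \<W> \<longrightarrow> card J \<le> Suc n \<longrightarrow> (\<forall>i<Suc n. (\<Sum>V\<in>J. c V * a V i) = 0) \<longrightarrow> (\<forall>V\<in>J. c V = 0)"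
    using general_position[OF \<open>finite \<W>\<close> half_gt_zero[OF \<open>\<epsilon> > 0\<close>], of "Suc n" "\<lambda>V i. h i (p V)"]
    by (elim exE conjE)
  have a: "\<bar>a V i - h i (p V)\<bar> < \<epsilon>/2" if "V \<in> \<W>" "i < Suc n" for V i
    using a_all that by simp
  have indep: "c V = 0"
    if "J \<subseteq> \<W>" "card J \<le> Suc n" "\<forall>i<Suc n. (\<Sum>V\<in>J. c V * a V i) = 0" "V \<in> J" for J c V
    using indep_all[THEN spec, THEN spec, THEN mp, OF that(1), of c] that(2-4) by simp
  \<comment> \<open>Bump functions whose support condition is exact: \<open>w V\<close> is nonzero precisely on \<open>V\<close>.
    The distance to the complement serves, except that \<open>infdist\<close> to the empty set is \<open>0\<close>.\<close>
  have "\<exists>w. continuous_on UNIV w \<and> (\<forall>y. 0 \<le> w y) \<and> (\<forall>y. w y \<noteq> (0::real) \<longleftrightarrow> y \<in> V)" if "V \<in> \<V>" for V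
  proof (cases "V = UNIV")
    case True
    then show ?thesis by (intro exI[of _ "\<lambda>_. 1"]) auto
  next
    case False
    then have "closed (-V)" "-V \<noteq> {}" using \<V>(2)[OF that] by auto
    then show ?thesis
      using in_closed_iff_infdist_zero[of "-V"]
      by (intro exI[of _ "\<lambda>y. infdist y (-V)"]) (auto intro: continuous_intros infdist_nonneg)
  qed
  then obtain w where w: "\<And>V. V \<in> \<V> \<Longrightarrow> continuous_on UNIV (w V)" "\<And>V y. V \<in> \<V> \<Longrightarrow> 0 \<le> w V y"
    "\<And>V y. V \<in> \<V> \<Longrightarrow> w V y \<noteq> (0::real) \<longleftrightarrow> y \<in> V"
    by metis
  have sub: "V \<in> \<V>" if "V \<in> \<W>" for V using that by (simp add: \<W>_def)
  define W where "W y = (\<Sum>V\<in>\<W>. w V y)" for y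
  have W_pos: "W y > 0" if "y \<in> Q" for y
  proof -
    obtain V where "V \<in> \<V>" "y \<in> V" using \<V>(3) by auto
    then have "V \<in> \<W>" "w V y > 0" using that w(2)[of V y] w(3)[of V y] by (auto simp: \<W>_def)
    then show ?thesis unfolding W_def using \<open>finite \<W>\<close> w(2) sub by (intro sum_pos2[of _ V]) auto
  qed
  define h' where "h' i y = (\<Sum>V\<in>\<W>. w V y * a V i) / W y" for i y
  show ?thesis
  proof (intro exI[of _ h'] conjI allI ballI impI)
    fix i :: nat assume i: "i < Suc n"
    have cw: "continuous_on Q (w V)" if "V \<in> \<W>" for V
      using w(1)[OF sub[OF that]] continuous_on_subset by blast
    show "continuous_on Q (h' i)"
      using W_pos unfolding h'_def W_def
      by (intro continuous_intros cw) (auto simp: less_le)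
  next
    fix i y assume i: "i < Suc n" and y: "y \<in> Q"
    have *: "\<bar>w V y * (a V i - h i y)\<bar> \<le> w V y * \<epsilon>" if "V \<in> \<W>" for V
    proof (cases "y \<in> V")
      case True
      obtain x where "V \<subseteq> ball x (\<delta>/2)" using \<V>(4)[OF sub[OF \<open>V \<in> \<W>\<close>]] by auto
      then have "dist (p V) y < \<delta>" using True p[OF that]
        by (metis IntD1 dist_triangle_half_r mem_ball subsetD)
      then have "\<bar>h i (p V) - h i y\<bar> < \<epsilon>/2" using \<delta> i y p[OF that] by auto
      then have "\<bar>a V i - h i y\<bar> \<le> \<epsilon>" using a[OF that i] by linarith
      then show ?thesis using w(2)[OF sub[OF that], of y] by (simp add: abs_mult mult_left_mono)
    next
      case False
      then show ?thesis using w(3)[OF sub[OF that], of y] by simp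
    qed
    have "h' i y - h i y = (\<Sum>V\<in>\<W>. w V y * (a V i - h i y)) / W y"
      using W_pos[OF y] by (simp add: h'_def field_simps W_def sum_subtractf sum_distrib_left sum_distrib_right)
    also have "\<bar>\<dots>\<bar> \<le> (\<Sum>V\<in>\<W>. w V y * \<epsilon>) / W y"
      using W_pos[OF y] * by (auto simp: abs_div intro!: divide_right_mono order_trans[OF sum_abs] sum_mono)
    also have "\<dots> = \<epsilon>" using W_pos[OF y] by (simp add: W_def flip: sum_distrib_right)
    finally show "\<bar>h' i y - h i y\<bar> \<le> \<epsilon>" .
  next
    fix y assume y: "y \<in> Q"
    show "\<exists>i<Suc n. h' i y \<noteq> 0"
    proof (rule ccontr)
      assume neg: "\<not> ?thesis"
      define J where "J = {V\<in>\<W>. y \<in> V}"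
      have "card J \<le> card {V\<in>\<V>. y \<in> V}"
        using \<V>(1) sub by (intro card_mono) (auto simp: J_def)
      then have "card J \<le> Suc n" using \<V>(5)[of y] by simp
      moreover have "(\<Sum>V\<in>J. w V y * a V i) = 0" if "i < Suc n" for i
      proof -
        have "(\<Sum>V\<in>J. w V y * a V i) = (\<Sum>V\<in>\<W>. w V y * a V i)"
          using \<open>finite \<W>\<close> w(3) sub by (intro sum.mono_neutral_left) (auto simp: J_def)
        then show ?thesis using neg that W_pos[OF y] by (auto simp: h'_def)
      qed
      ultimately have "w V y = 0" if "V \<in> J" for V
        using indep[of J "\<lambda>V. w V y" V] that by (auto simp: J_def)
      then have "W y = 0" using w(3) sub unfolding W_def J_def
        by (intro sum.neutral) fastforce
      then show False using W_pos[OF y] by simp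
    qed
  qed
qed

text \<open>
  On the compact set \<open>Q\<close> the sum of the \<open>\<bar>f (g i y)\<bar>\<close> has a positive minimum, and this leaves room
  for a uniformly small change of \<open>f\<close>.
\<close>
lemma open_avoiding_common_zero:
  fixes g :: "nat \<Rightarrow> 'a::metric_space \<Rightarrow> 'b::metric_space"
  assumes Q: "compact Q" and g: "\<And>i. i < m \<Longrightarrow> continuous_on Q (g i)"
  shows "open {f :: 'b \<Rightarrow>\<^sub>C real. \<forall>y\<in>Q. \<exists>i<m. f (g i y) \<noteq> 0}" (is "open ?U")
  unfolding open_dist
proof (intro ballI)
  fix f assume f: "f \<in> ?U"
  show "\<exists>e>0. \<forall>f'. dist f' f < e \<longrightarrow> f' \<in> ?U"
  proof (cases "Q = {}")
    case True
    then show ?thesis by (intro exI[of _ 1]) auto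
  next
    case False
    define s where "s y = (\<Sum>i<m. \<bar>f (g i y)\<bar>)" for y
    have "continuous_on Q (\<lambda>y. f (g i y))" if "i < m" for i
      by (rule continuous_on_compose2[OF continuous_on_apply_bcontfun[of UNIV] g[OF that]]) auto
    then have "continuous_on Q s" unfolding s_def by (intro continuous_intros) auto
    then obtain z where z: "z \<in> Q" "\<And>y. y \<in> Q \<Longrightarrow> s z \<le> s y"
      using continuous_attains_inf[OF Q False] by blast
    have "s z > 0"
    proof -
      obtain i where "i < m" "f (g i z) \<noteq> 0" using f z by auto
      then show ?thesis unfolding s_def by (intro sum_pos2[of _ i]) auto
    qed
    show ?thesis
    proof (intro exI[of _ "s z / Suc m"] conjI allI impI)
      show "0 < s z / Suc m" using \<open>s z > 0\<close> by simp
      fix f' assume f': "dist f' f < s z / Suc m"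
      show "f' \<in> ?U"
      proof (rule ccontr)
        assume "f' \<notin> ?U"
        then obtain y where y: "y \<in> Q" "\<And>i. i < m \<Longrightarrow> f' (g i y) = 0" by auto
        have "\<bar>f (g i y)\<bar> \<le> s z / Suc m" if "i < m" for i
          using dist_bounded[of f' "g i y" f] y(2)[OF that] f' by (simp add: dist_real_def)
        then have "s y \<le> (\<Sum>i<m. s z / Suc m)" unfolding s_def by (intro sum_mono) simp
        also have "\<dots> = m * (s z / Suc m)" by simp
        also have "\<dots> < s z" using \<open>s z > 0\<close> by (simp add: field_simps)
        finally show False using z(2)[OF y(1)] by simp
      qed
    qed
  qed
qed

text \<open>
  Since the embeddings \<open>g i\<close> have disjoint images, the values \<open>f (g i y)\<close> for different \<open>i\<close> can be
  prescribed independently of each other. So the perturbation of the map \<open>y \<mapsto> (f (g i y))\<^sub>i\<close> into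
  \<open>\<real>\<^bsup>n+1\<^esup>\<close> found above is carried to the images, and the Tietze extension theorem extends it to the
  whole space without enlarging it.
\<close>
lemma dense_avoiding_common_zero:
  fixes g :: "nat \<Rightarrow> 'a::metric_space \<Rightarrow> 'a"
  assumes X: "compact (UNIV::'a set)" and dim: "covering_dim_le (euclidean::'a topology) n"
    and Q: "compact Q" and g: "\<And>i. i < Suc n \<Longrightarrow> continuous_on Q (g i)"
    and inj: "\<And>i. i < Suc n \<Longrightarrow> inj_on (g i) Q"
    and disj: "\<And>i j. i < Suc n \<Longrightarrow> j < Suc n \<Longrightarrow> i \<noteq> j \<Longrightarrow> g i ` Q \<inter> g j ` Q = {}"
  shows "closure {f :: 'a \<Rightarrow>\<^sub>C real. \<forall>y\<in>Q. \<exists>i<Suc n. f (g i y) \<noteq> 0} = UNIV" (is "closure ?U = UNIV")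
proof -
  have "\<exists>f'\<in>?U. dist f' f < e" if "e > 0" for f :: "'a \<Rightarrow>\<^sub>C real" and e
  proof -
    have fg: "continuous_on Q (\<lambda>y. f (g i y))" if "i < Suc n" for i
      by (rule continuous_on_compose2[OF continuous_on_apply_bcontfun[of UNIV] g[OF that]]) auto
    have "\<exists>h. (\<forall>i<Suc n. continuous_on Q (h i)) \<and> (\<forall>i<Suc n. \<forall>y\<in>Q. \<bar>h i y - f (g i y)\<bar> \<le> e/2) \<and>
        (\<forall>y\<in>Q. \<exists>i<Suc n. h i y \<noteq> 0)"
      using \<open>e > 0\<close> by (intro perturb_to_avoid_common_zero[OF X dim Q] fg) auto
    then obtain h where h_all: "\<forall>i<Suc n. continuous_on Q (h i)" "\<forall>i<Suc n. \<forall>y\<in>Q. \<bar>h i y - f (g i y)\<bar> \<le> e/2"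
      and h_nz: "\<forall>y\<in>Q. \<exists>i<Suc n. h i y \<noteq> 0"
      by (elim exE conjE)
    have h: "continuous_on Q (h i)" if "i < Suc n" for i using h_all(1) that by simp
    have h_near: "\<bar>h i y - f (g i y)\<bar> \<le> e/2" if "i < Suc n" "y \<in> Q" for i y
      using h_all(2) that by simp
    \<comment> \<open>The wanted correction to \<open>f\<close> on the image of \<open>g i\<close>.\<close>
    define u where "u i z = h i (the_inv_into Q (g i) z) - f z" for i z
    have u_g: "u i (g i y) = h i y - f (g i y)" if "i < Suc n" "y \<in> Q" for i y
      using the_inv_into_f_f[OF inj[OF that(1)] that(2)] by (simp add: u_def)
    have cpt: "compact (g i ` Q)" if "i < Suc n" for i
      by (rule compact_continuous_image[OF g[OF that] Q])
    have cont_u: "continuous_on (g i ` Q) (u i)" if i: "i < Suc n" for i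
    proof -
      have "continuous_on (g i ` Q) (the_inv_into Q (g i))"
        using g[OF i] Q the_inv_into_f_f[OF inj[OF i]] by (intro continuous_on_inv) auto
      then have "continuous_on (g i ` Q) (\<lambda>z. h i (the_inv_into Q (g i) z))"
        by (rule continuous_on_compose2[OF h[OF i]])
          (auto simp: the_inv_into_f_f[OF inj[OF i]])
      then show ?thesis unfolding u_def by (intro continuous_intros) auto
    qed
    define ix where "ix z = (THE i. i < Suc n \<and> z \<in> g i ` Q)" for z
    have ix: "ix z = i" if "i < Suc n" "z \<in> g i ` Q" for z i
      unfolding ix_def using disj that by (intro the_equality) blast+
    define A where "A = (\<Union>i<Suc n. g i ` Q)"
    have "closed A" unfolding A_def using cpt by (intro closed_UN) (auto intro: compact_imp_closed)
    have "continuous_on A (\<lambda>z. u (ix z) z)"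
      unfolding A_def
    proof (rule continuous_on_closed_Union)
      fix i assume "i \<in> {..<Suc n}"
      then show "continuous_on (g i ` Q) (\<lambda>z. u (ix z) z)"
        using cont_u[of i] ix by (subst continuous_on_cong[of _ _ _ "u i"]) auto
    qed (use cpt in \<open>auto intro: compact_imp_closed\<close>)
    moreover have "(\<lambda>z. u (ix z) z) ` A \<subseteq> {-(e/2)..e/2}"
    proof
      fix r assume "r \<in> (\<lambda>z. u (ix z) z) ` A"
      then obtain i y where i: "i < Suc n" "y \<in> Q" "r = u (ix (g i y)) (g i y)" by (auto simp: A_def)
      then have "r = h i y - f (g i y)" using ix[of i "g i y"] u_g by simp
      then show "r \<in> {-(e/2)..e/2}" using h_near[OF i(1,2)] unfolding atLeastAtMost_iff by linarith
    qed
    moreover have "normal_space (euclidean::'a topology)"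
      by (simp add: metrizable_imp_normal_space metrizable_space_euclidean)
    ultimately obtain v where v: "continuous_on UNIV v" "\<And>z. z \<in> A \<Longrightarrow> v z = u (ix z) z"
      "range v \<subseteq> {-(e/2)..e/2}"
      using Tietze_extension_closed_real_interval[of euclidean A "\<lambda>z. u (ix z) z" "-(e/2)" "e/2"]
        \<open>closed A\<close> \<open>e > 0\<close> by auto
    have "\<bar>v z\<bar> \<le> e/2" for z
    proof -
      have "v z \<in> {-(e/2)..e/2}" using v(3) by blast
      then show ?thesis unfolding atLeastAtMost_iff by linarith
    qed
    then have "v \<in> bcontfun" using v(1) by (intro bcontfun_normI[of _ "e/2"]) auto
    then obtain w where w: "v = apply_bcontfun w" by (rule bcontfunE)
    have "f + w \<in> ?U"
    proof (intro CollectI ballI)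
      fix y assume y: "y \<in> Q"
      then obtain i where i: "i < Suc n" "h i y \<noteq> 0" using h_nz by auto
      have "v (g i y) = h i y - f (g i y)"
        using v(2)[of "g i y"] ix[OF i(1), of "g i y"] u_g[OF i(1) y] y i(1) by (auto simp: A_def)
      then show "\<exists>i<Suc n. (f + w) (g i y) \<noteq> 0" using i by (auto simp: w)
    qed
    moreover have "dist (f + w) f \<le> e/2"
      by (rule dist_bound) (use \<open>\<And>z. \<bar>v z\<bar> \<le> e/2\<close> w in \<open>auto simp: dist_real_def\<close>)
    ultimately show ?thesis using \<open>e > 0\<close> by (intro bexI[of _ "f + w"]) auto
  qed
  then show ?thesis by (auto simp: closure_approachable)
qed

lemma open_nonzero_at_point:
  "open {f :: 'a::metric_space \<Rightarrow>\<^sub>C real. f p \<noteq> 0}"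
  using open_avoiding_common_zero[of "{p}" 1 "\<lambda>_ y. y"] by auto

lemma dense_nonzero_at_point:
  "closure {f :: 'a::topological_space \<Rightarrow>\<^sub>C real. f p \<noteq> 0} = UNIV"
proof -
  have "\<exists>f'\<in>{f :: 'a \<Rightarrow>\<^sub>C real. f p \<noteq> 0}. dist f' f < e" if "e > 0" for f :: "'a \<Rightarrow>\<^sub>C real" and e
  proof (cases "f p = 0")
    case True
    have "dist (f + const_bcontfun (e/2)) f \<le> e/2"
      using \<open>e > 0\<close> by (intro dist_bound) (auto simp: dist_real_def const_bcontfun.rep_eq)
    then show ?thesis
      using True \<open>e > 0\<close> by (intro bexI[of _ "f + const_bcontfun (e/2)"]) (auto simp: const_bcontfun.rep_eq)
  next
    case False
    then show ?thesis using \<open>e > 0\<close> by (intro bexI[of _ f]) auto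
  qed
  then show ?thesis by (auto simp: closure_approachable)
qed

section \<open>Returns to a cross-section\<close>

lemma closed_imp_compact: "compact (UNIV::'a::metric_space set) \<Longrightarrow> closed S \<Longrightarrow> compact (S::'a set)"
  by (metis compact_Int_closed inf_top_left)

lemma flow_continuous_on: "topological_flow \<Phi> \<Longrightarrow> continuous_on A \<Phi>"
  unfolding topological_flow_def using continuous_on_subset by blast

text \<open>
  The injectivity time \<open>\<eta>\<close> applies to times in \<open>[-\<eta>, \<eta>]\<close>; by the flow law only the difference
  of the two times matters.
\<close>
lemma cross_section_unique_visit:
  assumes flow: "topological_flow \<Phi>" and S: "cross_section \<Phi> \<eta> S"
    and "y \<in> S" "y' \<in> S" "\<Phi> (y, t) = \<Phi> (y', t')" "\<bar>t - t'\<bar> \<le> \<eta>"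
  shows "y = y'" "t = t'"
proof -
  have "\<Phi> (y, t - t') = \<Phi> (\<Phi> (y, t), - t')" using flow by (simp add: topological_flow_def)
  also have "\<dots> = \<Phi> (y', 0)" unfolding assms(5) using flow by (simp add: topological_flow_def)
  finally have "\<Phi> (y, t - t') = \<Phi> (y', 0)" .
  moreover have "inj_on \<Phi> (S \<times> {-\<eta>..\<eta>})" "\<eta> > 0" using S by (auto simp: cross_section_def)
  ultimately have "(y, t - t') = (y', 0)"
    using assms by (intro inj_onD[of \<Phi> "S \<times> {-\<eta>..\<eta>}"]) auto
  then show "y = y'" "t = t'" by auto
qed

lemma cross_section_unique_return:
  assumes flow: "topological_flow \<Phi>" and S: "cross_section \<Phi> \<eta> S"
    and "\<Phi> (y, t) \<in> S" "\<Phi> (y, t') \<in> S" "\<bar>t - t'\<bar> \<le> \<eta>"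
  shows "t = t'"
proof -
  have "\<Phi> (\<Phi> (y, t), t' - t) = \<Phi> (\<Phi> (y, t'), 0)" using flow by (simp add: topological_flow_def)
  then show ?thesis using cross_section_unique_visit(2)[OF flow S assms(3,4)] assms(5) by fastforce
qed

text \<open>
  The points of \<open>S\<close> that return to \<open>S \<inter> C\<close> within a time window of length \<open>\<eta>\<close>. The return time is
  unique, so the compact set of pairs (point, return time) projects homeomorphically onto \<open>Q\<close>. This
  makes the return time continuous, and the return map is injective because the window is no longer
  than the injectivity time.
\<close>
lemma return_map:
  fixes \<Phi> :: "'a::metric_space \<times> real \<Rightarrow> 'a" and q :: real
  assumes X: "compact (UNIV::'a set)" and flow: "topological_flow \<Phi>"
    and S: "closed S" "cross_section \<Phi> \<eta> S" and C: "closed C"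
  defines "Q \<equiv> {y\<in>S. \<exists>t\<in>{q - \<eta>/2..q + \<eta>/2}. \<Phi> (y, t) \<in> S \<inter> C}"
  shows "\<exists>g. compact Q \<and> continuous_on Q g \<and> inj_on g Q \<and> g ` Q \<subseteq> S \<inter> C \<and>
    (\<forall>y\<in>Q. \<forall>t\<in>{q - \<eta>/2..q + \<eta>/2}. \<Phi> (y, t) \<in> S \<longrightarrow> g y = \<Phi> (y, t))"
proof -
  define P where "P = (S \<times> {q - \<eta>/2..q + \<eta>/2}) \<inter> \<Phi> -` (S \<inter> C)"
  have "closed (\<Phi> -` (S \<inter> C))"
    using flow S(1) C by (intro closed_vimage) (auto simp: topological_flow_def)
  then have "compact P"
    unfolding P_def by (intro compact_Int_closed compact_Times closed_imp_compact[OF X] S) auto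
  have Q: "Q = fst ` P" by (force simp: Q_def P_def)
  have uniq: "t = t'" if "\<Phi> (y, t) \<in> S" "\<Phi> (y, t') \<in> S"
    "t \<in> {q - \<eta>/2..q + \<eta>/2}" "t' \<in> {q - \<eta>/2..q + \<eta>/2}" for y t t'
    using cross_section_unique_return[OF flow S(2) that(1,2)] that(3,4) by (auto simp: abs_le_iff)
  then have inj: "inj_on fst P" by (auto simp: P_def intro!: inj_onI)
  define \<sigma> where "\<sigma> = the_inv_into P fst"
  have \<sigma>: "\<sigma> y \<in> P" "fst (\<sigma> y) = y" if "y \<in> Q" for y
    using the_inv_into_into[OF inj] f_the_inv_into_f[OF inj] that by (auto simp: Q \<sigma>_def)
  \<comment> \<open>A continuous bijection from a compact set is a homeomorphism.\<close>
  have "continuous_on Q \<sigma>"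
    unfolding Q using \<open>compact P\<close> the_inv_into_f_f[OF inj]
    by (intro continuous_on_inv) (auto simp: \<sigma>_def intro: continuous_intros)
  show ?thesis
  proof (intro exI[of _ "\<lambda>y. \<Phi> (\<sigma> y)"] conjI ballI impI)
    show "compact Q" unfolding Q by (intro compact_continuous_image \<open>compact P\<close> continuous_intros)
    show "continuous_on Q (\<lambda>y. \<Phi> (\<sigma> y))"
      by (rule continuous_on_compose2[OF flow_continuous_on[OF flow, of UNIV] \<open>continuous_on Q \<sigma>\<close>]) auto
    show "(\<lambda>y. \<Phi> (\<sigma> y)) ` Q \<subseteq> S \<inter> C" using \<sigma> by (auto simp: P_def)
    show "inj_on (\<lambda>y. \<Phi> (\<sigma> y)) Q"
    proof (rule inj_onI)
      fix y y' assume y: "y \<in> Q" "y' \<in> Q" "\<Phi> (\<sigma> y) = \<Phi> (\<sigma> y')"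
      obtain t t' where t: "\<sigma> y = (y, t)" "\<sigma> y' = (y', t')" using \<sigma>(2) y by (metis surjective_pairing)
      then have "(y, t) \<in> P" "(y', t') \<in> P" using \<sigma>(1) y by metis+
      then have "y \<in> S" "y' \<in> S" "\<bar>t - t'\<bar> \<le> \<eta>" by (auto simp: P_def abs_le_iff)
      then show "y = y'" using cross_section_unique_visit(1)[OF flow S(2)] y(3) t by metis
    qed
    fix y t assume y: "y \<in> Q" "t \<in> {q - \<eta>/2..q + \<eta>/2}" "\<Phi> (y, t) \<in> S"
    obtain t' where t': "\<sigma> y = (y, t')" using \<sigma>(2) y by (metis surjective_pairing)
    then have "(y, t') \<in> P" using \<sigma>(1) y by metis
    then have "t = t'" using uniq y by (auto simp: P_def)
    then show "\<Phi> (\<sigma> y) = \<Phi> (y, t)" using t' by simp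
  qed
qed

text \<open>
  On a cross-section no return happens before time \<open>\<eta>\<close>, so a point that comes back to itself at all
  has a least positive period.
\<close>
lemma periodic_in_periodic_orbits:
  fixes \<Phi> :: "'a::metric_space \<times> real \<Rightarrow> 'a"
  assumes flow: "topological_flow \<Phi>" and S: "cross_section \<Phi> \<eta> S"
    and y: "y \<in> S" "\<Phi> (y, \<tau>) = y" "\<tau> \<noteq> 0"
  shows "y \<in> \<Union>(periodic_orbits \<Phi>)"
proof -
  have "\<eta> > 0" using S by (simp add: cross_section_def)
  have fl: "\<Phi> (z, 0) = z" "\<Phi> (\<Phi> (z, a), b) = \<Phi> (z, b + a)" for z a b
    using flow by (auto simp: topological_flow_def)
  have gap: "t = 0" if "\<Phi> (y, t) = y" "\<bar>t\<bar> \<le> \<eta>" for t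
    using cross_section_unique_return[OF flow S, of y t 0] that y(1) fl(1) by simp
  have "\<Phi> (y, \<bar>\<tau>\<bar>) = y"
  proof (cases "\<tau> \<ge> 0")
    case False
    then show ?thesis using fl(2)[of y \<tau> "-\<tau>"] y(2) fl(1) by simp
  qed (use y in auto)
  define R where "R = {\<eta>..\<bar>\<tau>\<bar>} \<inter> (\<lambda>t. \<Phi> (y, t)) -` {y}"
  have "continuous_on UNIV (\<lambda>t. \<Phi> (y, t))"
    by (rule continuous_on_compose2[OF flow_continuous_on[OF flow, of UNIV]]) (auto intro!: continuous_intros)
  then have "closed ((\<lambda>t. \<Phi> (y, t)) -` {y})" by (intro closed_vimage) auto
  then have "compact R" unfolding R_def by (intro compact_Int_closed) auto
  moreover have "\<bar>\<tau>\<bar> \<in> R"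
    using gap[OF \<open>\<Phi> (y, \<bar>\<tau>\<bar>) = y\<close>] \<open>\<Phi> (y, \<bar>\<tau>\<bar>) = y\<close> y(3)
    by (cases "\<bar>\<tau>\<bar> \<le> \<eta>") (auto simp: R_def)
  ultimately obtain \<sigma> where \<sigma>: "\<sigma> \<in> R" "\<And>t. t \<in> R \<Longrightarrow> \<sigma> \<le> t"
    using compact_attains_inf[of R] by blast
  have "\<Phi> (y, t) \<noteq> y" if "0 < t" "t < \<sigma>" for t
  proof
    assume "\<Phi> (y, t) = y"
    then have "t \<in> R" using gap[of t] that \<sigma>(1) by (cases "t \<le> \<eta>") (auto simp: R_def)
    then show False using \<sigma>(2) that by force
  qed
  then have "periodic_with_period \<Phi> y \<sigma>"
    using \<sigma>(1) \<open>\<eta> > 0\<close> by (auto simp: periodic_with_period_def R_def)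
  then have "\<Phi> ` ({y} \<times> {0..\<sigma>}) \<in> periodic_orbits \<Phi>" by (auto simp: periodic_orbits_def)
  moreover have "y \<in> \<Phi> ` ({y} \<times> {0..\<sigma>})"
    using fl(1)[of y] \<sigma>(1) \<open>\<eta> > 0\<close> by (intro image_eqI[of _ _ "(y, 0)"]) (auto simp: R_def)
  ultimately show ?thesis by (rule UnionI)
qed

text \<open>
  The visits of one orbit to \<open>S\<close> are more than \<open>\<eta>\<close> apart in time, hence countable.
\<close>
lemma countable_periodic_in_cross_section:
  assumes flow: "topological_flow \<Phi>" and S: "cross_section \<Phi> \<eta> S"
    and "countable (periodic_orbits \<Phi>)"
  shows "countable (S \<inter> \<Union>(periodic_orbits \<Phi>))"
proof -
  have "\<eta> > 0" using S by (simp add: cross_section_def)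
  have "countable (S \<inter> E)" if E: "E \<in> periodic_orbits \<Phi>" for E
  proof -
    obtain x \<tau> where E_eq: "E = \<Phi> ` ({x} \<times> {0..\<tau>})"
      using E unfolding periodic_orbits_def by blast
    define T where "T = {t. \<Phi> (x, t) \<in> S}"
    have "inj_on (\<lambda>t. \<lfloor>t / \<eta>\<rfloor>) T"
    proof (rule inj_onI)
      fix t t' assume t: "t \<in> T" "t' \<in> T" "\<lfloor>t / \<eta>\<rfloor> = \<lfloor>t' / \<eta>\<rfloor>"
      have "\<bar>t / \<eta> - t' / \<eta>\<bar> < 1" using t(3) by linarith
      then have "\<bar>t - t'\<bar> / \<eta> < 1" using \<open>\<eta> > 0\<close> by (simp flip: diff_divide_distrib)
      then have "\<bar>t - t'\<bar> \<le> \<eta>" using \<open>\<eta> > 0\<close> by (simp add: divide_less_eq)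
      then show "t = t'" using cross_section_unique_return[OF flow S] t by (auto simp: T_def)
    qed
    then have "countable T" by (rule countable_image_inj_on[rotated]) auto
    moreover have "S \<inter> E \<subseteq> (\<lambda>t. \<Phi> (x, t)) ` T" by (auto simp: E_eq T_def)
    ultimately show ?thesis by (meson countable_image countable_subset)
  qed
  then have "countable (\<Union>E\<in>periodic_orbits \<Phi>. S \<inter> E)" using assms(3) by (intro countable_UN)
  then show ?thesis by (simp only: Int_Union)
qed

section \<open>Generic functions along orbits\<close>

text \<open>
  Closed balls with radius \<open>1/(k+1)\<close> around the points of a finite \<open>1/(k+1)\<close>-net, for all \<open>k\<close>.
\<close>
lemma countable_closed_network:
  assumes X: "compact (UNIV :: 'a::metric_space set)"
  obtains \<C> :: "'a::metric_space set set" where "countable \<C>" "\<And>C. C \<in> \<C> \<Longrightarrow> closed C"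
    "\<And>x r. r > 0 \<Longrightarrow> \<exists>C\<in>\<C>. x \<in> C \<and> C \<subseteq> ball x r"
proof -
  have "\<forall>k::nat. \<exists>D. finite D \<and> (UNIV::'a set) \<subseteq> (\<Union>c\<in>D. ball c (inverse (Suc k)))"
    using X unfolding compact_eq_totally_bounded by simp
  then obtain D where D: "\<forall>k::nat. finite (D k) \<and> (UNIV::'a set) \<subseteq> (\<Union>c\<in>D k. ball c (inverse (Suc k)))"
    by (rule choice[THEN exE])
  define \<C> where "\<C> = (\<Union>k. (\<lambda>c. cball c (inverse (Suc k))) ` D k)"
  show ?thesis
  proof
    show "countable \<C>" unfolding \<C>_def using D by (auto intro: countable_finite)
    show "closed C" if "C \<in> \<C>" for C using that by (auto simp: \<C>_def)
    fix x :: 'a and r :: real assume "r > 0"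
    then obtain k where k: "inverse (Suc k) < r / 2" using reals_Archimedean[of "r/2"] by auto
    obtain c where c: "c \<in> D k" "dist c x < inverse (Suc k)" 
    proof -
      have "x \<in> (\<Union>c\<in>D k. ball c (inverse (Suc k)))" using D[THEN spec, of k] by blast
      then show thesis using that by auto
    qed
    have "cball c (inverse (Suc k)) \<subseteq> ball x r"
    proof
      fix z assume "z \<in> cball c (inverse (Suc k))"
      then have "dist x z \<le> dist c x + inverse (Suc k)"
        using dist_triangle[of x z c] by (simp add: dist_commute)
      then show "z \<in> ball x r" using k c by simp
    qed
    then show "\<exists>C\<in>\<C>. x \<in> C \<and> C \<subseteq> ball x r"
      using c by (intro bexI[of _ "cball c (inverse (Suc k))"]) (auto simp: \<C>_def)
  qed
qed

text \<open>
  Prescribe disjoint closed sets \<open>C i\<close> and time windows around \<open>q i\<close>. The points of \<open>S\<close> that visit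
  every \<open>S \<inter> C i\<close> within its window form a compact set on which the return maps are embeddings with
  disjoint images; the functions that do not vanish at all \<open>n + 1\<close> visits at once are thus open and
  dense.
\<close>
lemma avoiding_visits_in_boxes:
  fixes \<Phi> :: "'a::metric_space \<times> real \<Rightarrow> 'a" and q :: "nat \<Rightarrow> real"
  assumes X: "compact (UNIV::'a set)" and dim: "covering_dim_le (euclidean::'a topology) n"
    and flow: "topological_flow \<Phi>" and S: "closed S" "cross_section \<Phi> \<eta> S"
    and C: "\<And>i. i < Suc n \<Longrightarrow> closed (C i)"
      "\<And>i j. i < Suc n \<Longrightarrow> j < Suc n \<Longrightarrow> i \<noteq> j \<Longrightarrow> C i \<inter> C j = {}"
  defines "U \<equiv> {f :: 'a \<Rightarrow>\<^sub>C real. \<forall>y\<in>S. \<forall>t. (\<forall>i<Suc n. t i \<in> {q i - \<eta>/2..q i + \<eta>/2} \<and> \<Phi> (y, t i) \<in> S \<inter> C i)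
      \<longrightarrow> (\<exists>i<Suc n. f (\<Phi> (y, t i)) \<noteq> 0)}"
  shows "open U" and "closure U = UNIV"
proof -
  define Q where "Q i = {y\<in>S. \<exists>t\<in>{q i - \<eta>/2..q i + \<eta>/2}. \<Phi> (y, t) \<in> S \<inter> C i}" for i
  have "\<forall>i\<in>{..<Suc n}. \<exists>g. compact (Q i) \<and> continuous_on (Q i) g \<and> inj_on g (Q i) \<and> g ` Q i \<subseteq> S \<inter> C i \<and>
    (\<forall>y\<in>Q i. \<forall>t\<in>{q i - \<eta>/2..q i + \<eta>/2}. \<Phi> (y, t) \<in> S \<longrightarrow> g y = \<Phi> (y, t))"
    unfolding Q_def using return_map[OF X flow S] C(1) by simp
  then obtain g where g_all: "\<forall>i\<in>{..<Suc n}. compact (Q i) \<and> continuous_on (Q i) (g i) \<and> inj_on (g i) (Q i) \<and>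
    g i ` Q i \<subseteq> S \<inter> C i \<and> (\<forall>y\<in>Q i. \<forall>t\<in>{q i - \<eta>/2..q i + \<eta>/2}. \<Phi> (y, t) \<in> S \<longrightarrow> g i y = \<Phi> (y, t))"
    by (rule bchoice[THEN exE])
  have g: "compact (Q i)" "continuous_on (Q i) (g i)" "inj_on (g i) (Q i)" "g i ` Q i \<subseteq> S \<inter> C i"
    if "i < Suc n" for i
    using g_all that by simp_all
  have g_eq: "g i y = \<Phi> (y, t)"
    if "i < Suc n" "y \<in> Q i" "t \<in> {q i - \<eta>/2..q i + \<eta>/2}" "\<Phi> (y, t) \<in> S" for i y t
    using g_all that by simp
  define Q' where "Q' = (\<Inter>i<Suc n. Q i)"
  have sub: "Q' \<subseteq> Q i" if "i < Suc n" for i using that by (auto simp: Q'_def)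
  have "closed Q'" unfolding Q'_def using g(1) by (intro closed_INT) (auto intro: compact_imp_closed)
  then have "compact Q'" by (rule closed_imp_compact[OF X])
  have U: "U = {f :: 'a \<Rightarrow>\<^sub>C real. \<forall>y\<in>Q'. \<exists>i<Suc n. f (g i y) \<noteq> 0}"
  proof (intro set_eqI iffI)
    fix f assume f: "f \<in> U"
    have "\<exists>i<Suc n. f (g i y) \<noteq> 0" if y: "y \<in> Q'" for y
    proof -
      have "\<forall>i\<in>{..<Suc n}. \<exists>t. t \<in> {q i - \<eta>/2..q i + \<eta>/2} \<and> \<Phi> (y, t) \<in> S \<inter> C i"
        using y unfolding Q'_def Q_def by blast
      then obtain t where t: "\<forall>i\<in>{..<Suc n}. t i \<in> {q i - \<eta>/2..q i + \<eta>/2} \<and> \<Phi> (y, t i) \<in> S \<inter> C i"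
        by (rule bchoice[THEN exE])
      have "y \<in> S" using sub[of 0] y by (auto simp: Q_def)
      then obtain i where i: "i < Suc n" "f (\<Phi> (y, t i)) \<noteq> 0" using f t unfolding U_def by blast
      then have "g i y = \<Phi> (y, t i)" using g_eq[of i y "t i"] sub y t by auto
      then show ?thesis using i by auto
    qed
    then show "f \<in> {f :: 'a \<Rightarrow>\<^sub>C real. \<forall>y\<in>Q'. \<exists>i<Suc n. f (g i y) \<noteq> 0}" by simp
  next
    fix f :: "'a \<Rightarrow>\<^sub>C real" assume f: "f \<in> {f :: 'a \<Rightarrow>\<^sub>C real. \<forall>y\<in>Q'. \<exists>i<Suc n. f (g i y) \<noteq> 0}"
    show "f \<in> U"
      unfolding U_def
    proof (intro CollectI ballI allI impI)
      fix y t assume y: "y \<in> S" and t: "\<forall>i<Suc n. t i \<in> {q i - \<eta>/2..q i + \<eta>/2} \<and> \<Phi> (y, t i) \<in> S \<inter> C i"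
      then have "y \<in> Q'" unfolding Q'_def Q_def by blast
      then obtain i where i: "i < Suc n" "f (g i y) \<noteq> 0" using f by auto
      then have "g i y = \<Phi> (y, t i)" using g_eq[of i y "t i"] sub \<open>y \<in> Q'\<close> t by auto
      then show "\<exists>i<Suc n. f (\<Phi> (y, t i)) \<noteq> 0" using i by auto
    qed
  qed
  have cont: "continuous_on Q' (g i)" if "i < Suc n" for i
    using g(2)[OF that] sub[OF that] by (rule continuous_on_subset)
  show "open U" unfolding U by (rule open_avoiding_common_zero[OF \<open>compact Q'\<close> cont])
  show "closure U = UNIV"
    unfolding U
  proof (rule dense_avoiding_common_zero[OF X dim \<open>compact Q'\<close> cont])
    show "inj_on (g i) Q'" if "i < Suc n" for i using g(3)[OF that] sub[OF that] by (rule inj_on_subset)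
    show "g i ` Q' \<inter> g j ` Q' = {}" if "i < Suc n" "j < Suc n" "i \<noteq> j" for i j
      using g(4)[OF that(1)] g(4)[OF that(2)] sub[OF that(1)] sub[OF that(2)] C(2)[OF that] by blast
  qed
qed

text \<open>
  Here \<open>P\<close> is an exceptional countable set. Any \<open>n + 1\<close> distinct points of \<open>S\<close> on one orbit lie in
  disjoint sets of a fixed countable network and are visited in time windows with rational centres.
  So countably many open dense conditions of the previous kind cover all such tuples, and Baire's
  theorem applies in the complete space of bounded continuous functions.
\<close>
lemma generic_function_avoids_visits:
  fixes \<Phi> :: "'a::metric_space \<times> real \<Rightarrow> 'a"
  assumes X: "compact (UNIV::'a set)" and dim: "covering_dim_le (euclidean::'a topology) n"
    and flow: "topological_flow \<Phi>" and S: "closed S" "cross_section \<Phi> \<eta> S"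
    and "countable P"
  shows "closure {f :: 'a \<Rightarrow>\<^sub>C real. (\<forall>p\<in>P. f p \<noteq> 0) \<and>
    (\<forall>y\<in>S. \<forall>t. (\<forall>i<Suc n. \<Phi> (y, t i) \<in> S) \<and> inj_on (\<lambda>i. \<Phi> (y, t i)) {..<Suc n} \<longrightarrow>
      (\<exists>i<Suc n. f (\<Phi> (y, t i)) \<noteq> 0))} = UNIV" (is "closure ?G = UNIV")
proof -
  have "\<eta> > 0" using S by (simp add: cross_section_def)
  obtain \<C> :: "'a set set" where \<C>: "countable \<C>" "\<And>C. C \<in> \<C> \<Longrightarrow> closed C"
    "\<And>x r. r > 0 \<Longrightarrow> \<exists>C\<in>\<C>. x \<in> C \<and> C \<subseteq> ball x r"
    using countable_closed_network[OF X] by metis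
  define D where "D = {d \<in> {..<Suc n} \<rightarrow>\<^sub>E (\<rat>::real set) \<times> \<C>. \<forall>i<Suc n. \<forall>j<Suc n. i \<noteq> j \<longrightarrow> snd (d i) \<inter> snd (d j) = {}}"
  define U where "U d = {f :: 'a \<Rightarrow>\<^sub>C real. \<forall>y\<in>S. \<forall>t.
      (\<forall>i<Suc n. t i \<in> {fst (d i) - \<eta>/2..fst (d i) + \<eta>/2} \<and> \<Phi> (y, t i) \<in> S \<inter> snd (d i))
      \<longrightarrow> (\<exists>i<Suc n. f (\<Phi> (y, t i)) \<noteq> 0)}" for d :: "nat \<Rightarrow> real \<times> 'a set"
  define \<G> where "\<G> = U ` D \<union> (\<lambda>p. {f :: 'a \<Rightarrow>\<^sub>C real. f p \<noteq> 0}) ` P"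
  have "countable ({..<Suc n} \<rightarrow>\<^sub>E (\<rat>::real set) \<times> \<C>)"
    by (intro countable_PiE countable_SIGMA countable_rat \<C>(1)) auto
  then have "countable D" unfolding D_def by (rule countable_subset[rotated]) auto
  then have "countable \<G>" unfolding \<G>_def using \<open>countable P\<close> by auto
  moreover have "openin euclidean T \<and> euclidean closure_of T = topspace euclidean" if "T \<in> \<G>" for T
  proof -
    have "open T \<and> closure T = UNIV"
      using that unfolding \<G>_def
    proof
      assume "T \<in> U ` D"
      then obtain d where d: "d \<in> D" "T = U d" by auto
      then have "closed (snd (d i))" if "i < Suc n" for i
        using \<C>(2) that by (auto simp: D_def PiE_iff mem_Times_iff)
      moreover have "snd (d i) \<inter> snd (d j) = {}" if "i < Suc n" "j < Suc n" "i \<noteq> j" for i j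
        using d(1) that unfolding D_def by blast
      ultimately show ?thesis
        unfolding d(2) U_def by (intro conjI avoiding_visits_in_boxes[OF X dim flow S])
    next
      assume "T \<in> (\<lambda>p. {f :: 'a \<Rightarrow>\<^sub>C real. f p \<noteq> 0}) ` P"
      then show ?thesis using open_nonzero_at_point dense_nonzero_at_point by auto
    qed
    then show ?thesis by simp
  qed
  ultimately have "closure (\<Inter>\<G>) = UNIV"
    using Baire_category[of "euclidean :: ('a \<Rightarrow>\<^sub>C real) topology" \<G>] completely_metrizable_space_euclidean by auto
  moreover have "\<Inter>\<G> \<subseteq> ?G"
  proof
    fix f assume f: "f \<in> \<Inter>\<G>"
    have "\<exists>i<Suc n. f (\<Phi> (y, t i)) \<noteq> 0"
      if y: "y \<in> S" and t: "\<forall>i<Suc n. \<Phi> (y, t i) \<in> S" "inj_on (\<lambda>i. \<Phi> (y, t i)) {..<Suc n}" for y t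
    proof -
      define z where "z i = \<Phi> (y, t i)" for i
      have "inj_on z {..<Suc n}" using t(2) unfolding z_def .
      \<comment> \<open>The element \<open>1\<close> keeps \<open>\<Delta>\<close> nonempty when there is only one index.\<close>
      define \<Delta> where "\<Delta> = insert 1 ((\<lambda>(i, j). dist (z i) (z j)) ` {(i, j) \<in> {..<Suc n} \<times> {..<Suc n}. i \<noteq> j})"
      have "finite ({(i, j) \<in> {..<Suc n} \<times> {..<Suc n}. i \<noteq> j})"
        by (rule finite_subset[of _ "{..<Suc n} \<times> {..<Suc n}"]) auto
      then have "finite \<Delta>" unfolding \<Delta>_def by (intro finite.insertI finite_imageI)
      define \<delta> where "\<delta> = Min \<Delta>"
      have "\<delta> > 0"
        unfolding \<delta>_def using \<open>finite \<Delta>\<close> \<open>inj_on z _\<close>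
        by (subst Min_gr_iff) (auto simp: \<Delta>_def dest: inj_onD)
      have sep: "\<delta> \<le> dist (z i) (z j)" if "i < Suc n" "j < Suc n" "i \<noteq> j" for i j
        unfolding \<delta>_def using \<open>finite \<Delta>\<close> that by (intro Min_le) (auto simp: \<Delta>_def)
      have "\<exists>q. q \<in> \<rat> \<and> t i \<in> {q - \<eta>/2..q + \<eta>/2}" for i
      proof -
        obtain q where "q \<in> \<rat>" "t i - \<eta>/2 < q" "q < t i + \<eta>/2"
          using Rats_dense_in_real[of "t i - \<eta>/2" "t i + \<eta>/2"] \<open>\<eta> > 0\<close> by auto
        then show ?thesis by (intro exI[of _ q]) auto
      qed
      then obtain q where q: "\<And>i. q i \<in> \<rat>" "\<And>i. t i \<in> {q i - \<eta>/2..q i + \<eta>/2}" by metis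
      have "\<forall>i. \<exists>C. C \<in> \<C> \<and> z i \<in> C \<and> C \<subseteq> ball (z i) (\<delta>/2)"
        using \<C>(3)[OF half_gt_zero[OF \<open>\<delta> > 0\<close>]] by blast
      then obtain C where "\<forall>i. C i \<in> \<C> \<and> z i \<in> C i \<and> C i \<subseteq> ball (z i) (\<delta>/2)"
        by (rule choice[THEN exE])
      then have C: "C i \<in> \<C>" "z i \<in> C i" "C i \<subseteq> ball (z i) (\<delta>/2)" for i by blast+
      define d where "d = restrict (\<lambda>i. (q i, C i)) {..<Suc n}"
      have "C i \<inter> C j = {}" if "i < Suc n" "j < Suc n" "i \<noteq> j" for i j
      proof -
        have "ball (z i) (\<delta>/2) \<inter> ball (z j) (\<delta>/2) = {}"
          using sep[OF that] by (intro disjoint_ballI) simp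
        then show ?thesis using C(3)[of i] C(3)[of j] by blast
      qed
      then have "d \<in> D" using q(1) C(1) by (auto simp: D_def d_def)
      then have "f \<in> U d" using f by (auto simp: \<G>_def)
      moreover have "\<forall>i<Suc n. t i \<in> {fst (d i) - \<eta>/2..fst (d i) + \<eta>/2} \<and> \<Phi> (y, t i) \<in> S \<inter> snd (d i)"
        using q(2) C(2) t(1) by (auto simp: d_def z_def)
      ultimately show ?thesis using y unfolding U_def by blast
    qed
    moreover have "f p \<noteq> 0" if "p \<in> P" for p using f that by (auto simp: \<G>_def)
    ultimately show "f \<in> ?G" by simp
  qed
  ultimately show ?thesis using closure_mono by blast
qed

section \<open>Rarely visited sets are null\<close>

text \<open>
  Integrate the number of visits to \<open>A\<close> among the first \<open>N\<close> iterates of the map \<open>\<Phi>\<^sub>s\<close>: by invariance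
  the result is \<open>N\<close> times the measure of \<open>A\<close>, yet it is at most \<open>n\<close> for every \<open>N\<close>.
\<close>
lemma bounded_visits_imp_null:
  fixes \<Phi> :: "'a::metric_space \<times> real \<Rightarrow> 'a"
  assumes flow: "topological_flow \<Phi>" and M: "invariant_prob \<Phi> M" and A: "A \<in> sets borel"
    and visits: "\<And>y (K::nat set). finite K \<Longrightarrow> (\<And>k. k \<in> K \<Longrightarrow> \<Phi> (y, k * s) \<in> A) \<Longrightarrow> card K \<le> n"
  shows "emeasure M A = 0"
proof -
  interpret prob_space M using M by (simp add: invariant_prob_def)
  have sets_M: "sets M = sets borel" using M by (simp add: invariant_prob_def)
  then have space_M: "space M = UNIV" using sets_eq_imp_space_eq[of M borel] by simp
  define T where "T k x = \<Phi> (x, real k * s)" for k x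
  have "continuous_on UNIV (T k)" for k
    unfolding T_def
    by (rule continuous_on_compose2[OF flow_continuous_on[OF flow, of UNIV]]) (auto intro!: continuous_intros)
  then have "T k \<in> borel \<rightarrow>\<^sub>M borel" for k by (rule borel_measurable_continuous_onI)
  then have meas: "T k \<in> M \<rightarrow>\<^sub>M M" for k using measurable_cong_sets[OF sets_M sets_M] by simp
  have T_sets: "T k -` A \<in> sets M" for k
    using measurable_sets[OF meas, of A k] A sets_M space_M by simp
  have T_measure: "measure M (T k -` A) = measure M A" for k
  proof -
    have "measure M A = measure (distr M M (T k)) A"
      using M unfolding invariant_prob_def T_def by metis
    also have "\<dots> = measure M (T k -` A)"
      using measure_distr[OF meas, of A k] A sets_M space_M by simp
    finally show ?thesis by simp
  qed
  have integrable: "integrable M (indicator (T k -` A) :: _ \<Rightarrow> real)" for k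
    using T_sets by (intro integrable_real_indicator) (simp_all add: emeasure_eq_measure)
  have bound: "real N * measure M A \<le> n" for N
  proof -
    have "real N * measure M A = (\<Sum>k<N. \<integral>x. indicator (T k -` A) x \<partial>M)"
      using T_sets by (simp add: T_measure)
    also have "\<dots> = (\<integral>x. (\<Sum>k<N. indicator (T k -` A) x) \<partial>M)"
      by (rule Bochner_Integration.integral_sum[symmetric]) (rule integrable)
    also have "\<dots> \<le> (\<integral>x. real n \<partial>M)"
    proof (rule integral_mono)
      show "integrable M (\<lambda>x. \<Sum>k<N. indicator (T k -` A) x :: real)"
        by (rule Bochner_Integration.integrable_sum) (rule integrable)
      show "integrable M (\<lambda>x. real n)" by (rule integrable_const)
      fix x
      have "(\<Sum>k<N. indicator (T k -` A) x :: real) = real (card ({..<N} \<inter> {k. T k x \<in> A}))"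
        by (simp add: indicator_def sum.If_cases)
      also have "\<dots> \<le> n" by (intro of_nat_mono visits[where y = x]) (auto simp: T_def)
      finally show "(\<Sum>k<N. indicator (T k -` A) x) \<le> real n" .
    qed
    also have "\<dots> = n" by (simp add: prob_space)
    finally show ?thesis .
  qed
  have "measure M A = 0"
  proof (rule ccontr)
    assume "measure M A \<noteq> 0"
    then have "measure M A > 0" by (simp add: less_le)
    then obtain N where "real n < real N * measure M A"
      using reals_Archimedean3 by blast
    then show False using bound[of N] by simp
  qed
  then show ?thesis by (simp add: emeasure_eq_measure)
qed

text \<open>
  If no orbit contains \<open>n + 1\<close> distinct points of \<open>B\<close> and \<open>B\<close> contains no periodic point, then
  an orbit can be in the \<open>\<eta>\<close>-thickening of \<open>B\<close> for at most \<open>n\<close> multiples of \<open>3\<eta>\<close>. The step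
  \<open>3\<eta>\<close> is longer than the thickness \<open>2\<eta>\<close>, so that different multiples belong to visits of
  \<open>B\<close> at different times.
\<close>
lemma finite_visits_imp_flow_null:
  fixes \<Phi> :: "'a::metric_space \<times> real \<Rightarrow> 'a"
  assumes X: "compact (UNIV::'a set)" and flow: "topological_flow \<Phi>"
    and S: "cross_section \<Phi> \<eta> S" and B: "closed B" "B \<subseteq> S" "B \<inter> \<Union>(periodic_orbits \<Phi>) = {}"
    and visits: "\<And>y t. y \<in> B \<Longrightarrow> inj_on (\<lambda>i. \<Phi> (y, t i)) {..<Suc n} \<Longrightarrow> \<exists>i<Suc n. \<Phi> (y, t i) \<notin> B"
  shows "flow_null \<Phi> (\<Phi> ` (B \<times> {-\<eta>..\<eta>}))"
proof -
  have "\<eta> > 0" using S by (simp add: cross_section_def)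
  have fl: "\<Phi> (\<Phi> (z, a), b) = \<Phi> (z, b + a)" for z a b
    using flow by (auto simp: topological_flow_def)
  define A where "A = \<Phi> ` (B \<times> {-\<eta>..\<eta>})"
  have "compact A"
    unfolding A_def
    by (intro compact_continuous_image compact_Times flow_continuous_on[OF flow] closed_imp_compact[OF X] B) auto
  then have "A \<in> sets borel" by (intro borel_closed compact_imp_closed)
  have "card K \<le> n" if K: "finite K" "\<And>k. k \<in> K \<Longrightarrow> \<Phi> (y, k * (3 * \<eta>)) \<in> A" for y and K :: "nat set"
  proof (rule ccontr)
    assume "\<not> card K \<le> n"
    then obtain K' where K': "K' \<subseteq> K" "card K' = Suc n" "finite K'"
      using obtain_subset_with_card_n[of "Suc n" K] by (metis not_less_eq_eq)
    then obtain h where h: "bij_betw h {0..<Suc n} K'" using ex_bij_betw_nat_finite by metis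
    \<comment> \<open>Move each visit to the thickening along the flow to a visit to \<open>B\<close> itself.\<close>
    have "\<forall>i\<in>{..<Suc n}. \<exists>u. \<bar>u\<bar> \<le> \<eta> \<and> \<Phi> (y, h i * (3 * \<eta>) - u) \<in> B"
    proof
      fix i assume i: "i \<in> {..<Suc n}"
      have "h i \<in> K" using bij_betwE[OF h] K'(1) i by auto
      then have "\<Phi> (y, h i * (3 * \<eta>)) \<in> A" by (rule K(2))
      then obtain z u where z: "z \<in> B" "u \<in> {-\<eta>..\<eta>}" "\<Phi> (y, h i * (3 * \<eta>)) = \<Phi> (z, u)"
        unfolding A_def by blast
      have "\<Phi> (y, h i * (3 * \<eta>) - u) = \<Phi> (\<Phi> (z, u), - u)"
        using fl[of y "h i * (3 * \<eta>)" "- u"] by (simp add: z(3))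
      also have "\<dots> = z" using fl[of z u "- u"] flow unfolding topological_flow_def by simp
      finally have "\<Phi> (y, h i * (3 * \<eta>) - u) = z" .
      moreover have "\<bar>u\<bar> \<le> \<eta>" using z(2) by auto
      ultimately show "\<exists>u. \<bar>u\<bar> \<le> \<eta> \<and> \<Phi> (y, h i * (3 * \<eta>) - u) \<in> B"
        using z(1) by blast
    qed
    then obtain u where "\<forall>i\<in>{..<Suc n}. \<bar>u i\<bar> \<le> \<eta> \<and> \<Phi> (y, h i * (3 * \<eta>) - u i) \<in> B"
      by (rule bchoice[THEN exE])
    then have u: "\<bar>u i\<bar> \<le> \<eta>" "\<Phi> (y, h i * (3 * \<eta>) - u i) \<in> B" if "i < Suc n" for i
      using that by blast+
    define T where "T i = h i * (3 * \<eta>) - u i" for i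
    define z where "z i = \<Phi> (y, T i)" for i
    have z_B: "z i \<in> B" if "i < Suc n" for i using u(2)[OF that] by (simp add: z_def T_def)
    have z_flow: "\<Phi> (z i, T j - T i) = z j" for i j by (simp add: z_def fl)
    \<comment> \<open>Two equal points among the \<open>z i\<close> would be periodic, as the times \<open>T i\<close> differ by at least \<open>\<eta>\<close>.\<close>
    have "inj_on z {..<Suc n}"
    proof (rule inj_onI, rule ccontr)
      fix i j assume ij: "i \<in> {..<Suc n}" "j \<in> {..<Suc n}" "z i = z j" "i \<noteq> j"
      then have "h i \<noteq> h j" using h by (auto simp: bij_betw_def dest: inj_onD)
      then have "\<bar>real (h i) - real (h j)\<bar> \<ge> 1" by linarith
      then have "\<bar>real (h i) - real (h j)\<bar> * (3 * \<eta>) \<ge> 1 * (3 * \<eta>)"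
        using \<open>\<eta> > 0\<close> by (intro mult_right_mono) auto
      then have "\<bar>h i * (3 * \<eta>) - h j * (3 * \<eta>)\<bar> \<ge> 3 * \<eta>"
        using \<open>\<eta> > 0\<close> by (simp add: abs_mult flip: left_diff_distrib)
      then have "T j - T i \<noteq> 0" using u(1)[of i] u(1)[of j] ij \<open>\<eta> > 0\<close> unfolding T_def by auto
      then have "z i \<in> \<Union>(periodic_orbits \<Phi>)"
        using periodic_in_periodic_orbits[OF flow S, of "z i" "T j - T i"] z_flow[of i j] z_B[of i] ij B(2) by auto
      then show False using B(3) z_B ij by auto
    qed
    then have "inj_on (\<lambda>i. \<Phi> (z 0, T i - T 0)) {..<Suc n}" by (simp add: z_flow)
    then obtain i where "i < Suc n" "\<Phi> (z 0, T i - T 0) \<notin> B"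
      using visits[of "z 0" "\<lambda>i. T i - T 0"] z_B[of 0] by auto
    then show False using z_B z_flow by simp
  qed
  then have "emeasure M A = 0" if "invariant_prob \<Phi> M" for M
    using bounded_visits_imp_null[OF flow that \<open>A \<in> sets borel\<close>, of "3 * \<eta>" n] by blast
  then show ?thesis using \<open>A \<in> sets borel\<close> by (simp add: flow_null_def A_def)
qed

section \<open>Small flow boundaries\<close>

text \<open>
  Near \<open>y\<close> every point is \<open>\<Phi>\<^sub>t(z)\<close> with \<open>z \<in> S\<close> and small \<open>t\<close>. Those with \<open>f z \<ge> 0\<close> form a compact
  set, which misses \<open>y\<close> because the cross-section coordinate of \<open>y\<close> is \<open>y\<close> itself.
\<close>
lemma sublevel_flow_interior:
  fixes \<Phi> :: "'a::metric_space \<times> real \<Rightarrow> 'a" and f :: "'a \<Rightarrow> real"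
  assumes X: "compact (UNIV::'a set)" and flow: "topological_flow \<Phi>"
    and S: "closed S" "cross_section \<Phi> \<eta> S" and f: "continuous_on UNIV f"
    and y: "y \<in> flow_interior \<Phi> \<eta> S" "f y < 0"
  shows "y \<in> flow_interior \<Phi> \<eta> {z\<in>S. f z \<le> 0}"
proof -
  have "\<eta> > 0" using S by (simp add: cross_section_def)
  define W where "W = interior (\<Phi> ` (S \<times> {-(\<eta>/2)..\<eta>/2}))"
  define K where "K = \<Phi> ` ({z\<in>S. f z \<ge> 0} \<times> {-(\<eta>/2)..\<eta>/2})"
  have "closed (S \<inter> {z. f z \<ge> 0})" by (intro closed_Int S(1) closed_Collect_le f continuous_on_const)
  then have "compact {z\<in>S. f z \<ge> 0}" using closed_imp_compact[OF X] by (simp add: Int_def)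
  then have "closed K"
    unfolding K_def by (intro compact_imp_closed compact_continuous_image compact_Times flow_continuous_on[OF flow]) auto
  have "y \<in> W" "y \<in> S" using y(1) by (auto simp: flow_interior_def W_def)
  have "y \<notin> K"
  proof
    assume "y \<in> K"
    then obtain z t where z: "z \<in> S" "f z \<ge> 0" "t \<in> {-(\<eta>/2)..\<eta>/2}" "y = \<Phi> (z, t)" by (auto simp: K_def)
    moreover have "\<Phi> (y, 0) = y" using flow by (simp add: topological_flow_def)
    ultimately have "z = y" using \<open>y \<in> S\<close> \<open>\<eta> > 0\<close>
      by (intro cross_section_unique_visit(1)[OF flow S(2), of z y t 0]) auto
    then show False using z(2) y(2) by simp
  qed
  have "W - K \<subseteq> \<Phi> ` ({z\<in>S. f z \<le> 0} \<times> {-(\<eta>/2)..\<eta>/2})"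
  proof
    fix w assume w: "w \<in> W - K"
    then obtain z t where z: "z \<in> S" "t \<in> {-(\<eta>/2)..\<eta>/2}" "w = \<Phi> (z, t)"
      using interior_subset unfolding W_def by blast
    then have "f z \<le> 0" using w unfolding K_def by force
    then show "w \<in> \<Phi> ` ({z\<in>S. f z \<le> 0} \<times> {-(\<eta>/2)..\<eta>/2})" using z by blast
  qed
  moreover have "open (W - K)" unfolding W_def using \<open>closed K\<close> by blast
  ultimately show ?thesis
    using \<open>y \<in> W\<close> \<open>y \<notin> K\<close> \<open>y \<in> S\<close> y(2) unfolding flow_interior_def
    by (auto intro: interiorI)
qed

theorem theoremA:
  fixes \<Phi> :: "'a::metric_space \<times> real \<Rightarrow> 'a"
  assumes "compact (UNIV :: 'a set)"
    and "finite_covering_dim (euclidean :: 'a topology)"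
    and "topological_flow \<Phi>"
    and "\<And>x. \<not> fixed_point \<Phi> x"
    and "countable (periodic_orbits \<Phi>)"
  shows "small_flow_boundary_property \<Phi>"
  unfolding small_flow_boundary_property_def
proof (intro allI impI, elim conjE)
  note X = assms(1) and flow = assms(3)
  fix x \<eta> and S' :: "'a set"
  assume S': "closed S'" "cross_section \<Phi> \<eta> S'" and x: "x \<in> flow_interior \<Phi> \<eta> S'"
  obtain n where dim: "covering_dim_le (euclidean :: 'a topology) n"
    using assms(2) by (auto simp: finite_covering_dim_def)
  define P where "P = S' \<inter> \<Union>(periodic_orbits \<Phi>)"
  have "countable P"
    unfolding P_def by (rule countable_periodic_in_cross_section[OF flow S'(2) assms(5)])
  obtain r where r: "r > 0" "ball x (2 * r) \<subseteq> interior (\<Phi> ` (S' \<times> {-(\<eta>/2)..\<eta>/2}))"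
  proof -
    obtain e where "e > 0" "ball x e \<subseteq> interior (\<Phi> ` (S' \<times> {-(\<eta>/2)..\<eta>/2}))"
      using x open_contains_ball[of "interior (\<Phi> ` (S' \<times> {-(\<eta>/2)..\<eta>/2}))"] by (auto simp: flow_interior_def)
    then show thesis by (intro that[of "e/2"]) auto
  qed
  have "continuous_on UNIV (\<lambda>y. dist x y - r)" by (intro continuous_intros)
  moreover from this have "bounded (range (\<lambda>y. dist x y - r))"
    using X by (intro compact_imp_bounded compact_continuous_image)
  ultimately have "(\<lambda>y. dist x y - r) \<in> bcontfun" by (simp add: bcontfun_def)
  then obtain f\<^sub>0 where f\<^sub>0: "(\<lambda>y. dist x y - r) = apply_bcontfun f\<^sub>0" by (rule bcontfunE)
  obtain f :: "'a \<Rightarrow>\<^sub>C real" where near: "dist f f\<^sub>0 < r" and f_P: "\<And>p. p \<in> P \<Longrightarrow> f p \<noteq> 0"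
    and f_visits: "\<forall>y\<in>S'. \<forall>t. (\<forall>i<Suc n. \<Phi> (y, t i) \<in> S') \<and> inj_on (\<lambda>i. \<Phi> (y, t i)) {..<Suc n} \<longrightarrow>
      (\<exists>i<Suc n. f (\<Phi> (y, t i)) \<noteq> 0)"
  proof -
    have "f\<^sub>0 \<in> closure {f :: 'a \<Rightarrow>\<^sub>C real. (\<forall>p\<in>P. f p \<noteq> 0) \<and>
      (\<forall>y\<in>S'. \<forall>t. (\<forall>i<Suc n. \<Phi> (y, t i) \<in> S') \<and> inj_on (\<lambda>i. \<Phi> (y, t i)) {..<Suc n} \<longrightarrow>
        (\<exists>i<Suc n. f (\<Phi> (y, t i)) \<noteq> 0))}"
      unfolding generic_function_avoids_visits[OF X dim flow S' \<open>countable P\<close>] by simp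
    then show thesis
      using \<open>r > 0\<close> that unfolding closure_approachable by (elim allE[of _ r] impE bexE CollectE conjE) auto
  qed
  have f_near: "\<bar>f y - (dist x y - r)\<bar> < r" for y
    using dist_fun_lt_imp_dist_val_lt[OF near, of y] by (simp add: dist_real_def flip: f\<^sub>0)
  \<comment> \<open>The closed sublevel set lies within distance \<open>2r\<close> of \<open>x\<close>, inside the flow interior of \<open>S'\<close>.\<close>
  define S where "S = {y\<in>S'. f y \<le> 0}"
  have "closed (S' \<inter> {y. f y \<le> 0})"
    by (intro closed_Int S'(1) closed_Collect_le continuous_on_apply_bcontfun continuous_on_const)
  then have "closed S" by (simp add: S_def Int_def)
  have S_int: "y \<in> flow_interior \<Phi> \<eta> S'" if "y \<in> S" for y
  proof -
    have "f y \<le> 0" using that by (simp add: S_def)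
    then have "dist x y < 2 * r" using f_near[of y] by linarith
    then show ?thesis using r(2) that by (auto simp: flow_interior_def S_def)
  qed
  have neg_int: "y \<in> flow_interior \<Phi> \<eta> S" if "y \<in> S" "f y < 0" for y
    using sublevel_flow_interior[OF X flow S' continuous_on_apply_bcontfun[of UNIV f] S_int[OF that(1)] that(2)]
    by (simp add: S_def)
  have "f x < 0" using f_near[of x] by simp
  moreover have "x \<in> S'" using x by (simp add: flow_interior_def)
  ultimately have x_int: "x \<in> flow_interior \<Phi> \<eta> S" by (intro neg_int) (auto simp: S_def)
  define B where "B = flow_boundary \<Phi> \<eta> S"
  have "B = S - interior (\<Phi> ` (S \<times> {-(\<eta>/2)..\<eta>/2}))"
    using \<open>closed S\<close> by (auto simp: B_def flow_boundary_def flow_interior_def)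
  then have "closed B" using \<open>closed S\<close> by (simp add: closed_Diff)
  \<comment> \<open>The flow boundary is contained in the zero level of \<open>f\<close>.\<close>
  have B: "y \<in> S'" "f y = 0" if "y \<in> B" for y
  proof -
    have "y \<in> S" "y \<notin> flow_interior \<Phi> \<eta> S" using that \<open>closed S\<close> by (auto simp: B_def flow_boundary_def)
    then show "y \<in> S'" "f y = 0" using neg_int[of y] by (force simp: S_def)+
  qed
  have "flow_null \<Phi> (\<Phi> ` (B \<times> {-\<eta>..\<eta>}))"
  proof (rule finite_visits_imp_flow_null[OF X flow S'(2) \<open>closed B\<close>, of n])
    show "B \<subseteq> S'" using B by auto
    show "B \<inter> \<Union>(periodic_orbits \<Phi>) = {}" using B f_P by (auto simp: P_def)
    show "\<exists>i<Suc n. \<Phi> (y, t i) \<notin> B" if "y \<in> B" "inj_on (\<lambda>i. \<Phi> (y, t i)) {..<Suc n}" for y t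
      using f_visits[rule_format, of y t] B that by blast
  qed
  moreover have "cross_section \<Phi> \<eta> S"
    using S'(2) unfolding cross_section_def by (auto simp: S_def elim: inj_on_subset)
  ultimately have "small_flow_boundary \<Phi> \<eta> S"
    using \<open>closed S\<close> by (simp add: small_flow_boundary_def B_def)
  then show "\<exists>S. closed S \<and> S \<subseteq> S' \<and> x \<in> flow_interior \<Phi> \<eta> S \<and> small_flow_boundary \<Phi> \<eta> S"
    using \<open>closed S\<close> x_int by (intro exI[of _ S]) (auto simp: S_def)
qed

end
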